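(* Let $\lambda$ be an infinite cardinal. Then $(\mathscr{I}^{\infty}_\lambda,\tau_F)$ is a Tychonoff topological inverse semigroup.
   Context: For an infinite cardinal $\lambda$ (regarded as a set), $\mathscr{I}_\lambda$ is the symmetric inverse semigroup of all partial one-to-one maps from $\lambda$ to $\lambda$; maps are written on the right and composed left to right: $(x)(\alpha\beta)=((x)\alpha)\beta$ for $x\in\operatorname{dom}(\alpha\beta)=\{y\in\operatorname{dom}\alpha\mid (y)\alpha\in\operatorname{dom}\beta\}$. A map $\alpha\in\mathscr{I}_\lambda$ is almost everywhere the identity if $\lambda\setminus\operatorname{dom}\alpha$ is finite and $(x)\alpha\neq x$ only for finitely many $x\in\operatorname{dom}\alpha$. $\mathscr{I}^{\infty}_\lambda\subseteq\mathscr{I}_\lambda$ is the inverse subsemigroup of all such maps. The topology $\tau_F$ on $\mathscr{I}^{\infty}_\lambda$ is the one for which, for each $\alpha\in\mathscr{I}^{\infty}_\lambda$, the family $\mathscr{B}_F(\alpha)=\{U_\alpha(F)\mid F\text{ is a finite subset of }\operatorname{dom}\alpha\}$ is a base of open neighbourhoods at $\alpha$, where $$U_\alpha(F)=\{\beta\in\mathscr{I}^{\infty}_\lambda\mid\operatorname{dom}\alpha=\operatorname{dom}\beta,\ \operatorname{ran}\alpha=\operatorname{ran}\beta\text{ and }(x)\beta=(x)\alpha\text{ for all }x\in F\}.$$ A topological inverse semigroup is an inverse semigroup with a topology for which the multiplication is jointly continuous and the inversion $x\mapsto x^{-1}$ is continuous. Tychonoff means completely regular and Hausdorff. *)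

theory Defs
  imports "HOL-Analysis.Analysis"
begin

section \<open>Inverse semigroups and topological inverse semigroups\<close>

definition semigroup_on :: "'s set \<Rightarrow> ('s \<Rightarrow> 's \<Rightarrow> 's) \<Rightarrow> bool" where
  "semigroup_on S m \<longleftrightarrow>
     (\<forall>x\<in>S. \<forall>y\<in>S. m x y \<in> S) \<and>
     (\<forall>x\<in>S. \<forall>y\<in>S. \<forall>z\<in>S. m (m x y) z = m x (m y z))"

definition is_inverse_of :: "('s \<Rightarrow> 's \<Rightarrow> 's) \<Rightarrow> 's \<Rightarrow> 's \<Rightarrow> bool" where
  "is_inverse_of m x y \<longleftrightarrow> m (m x y) x = x \<and> m (m y x) y = y"

definition inverse_semigroup_on :: "'s set \<Rightarrow> ('s \<Rightarrow> 's \<Rightarrow> 's) \<Rightarrow> bool" where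
  "inverse_semigroup_on S m \<longleftrightarrow>
     semigroup_on S m \<and> (\<forall>x\<in>S. \<exists>!y. y \<in> S \<and> is_inverse_of m x y)"

definition semigroup_inverse :: "'s set \<Rightarrow> ('s \<Rightarrow> 's \<Rightarrow> 's) \<Rightarrow> 's \<Rightarrow> 's" where
  "semigroup_inverse S m x = (THE y. y \<in> S \<and> is_inverse_of m x y)"

definition topological_inverse_semigroup ::
  "'s set \<Rightarrow> ('s \<Rightarrow> 's \<Rightarrow> 's) \<Rightarrow> 's topology \<Rightarrow> bool" where
  "topological_inverse_semigroup S m T \<longleftrightarrow>
     inverse_semigroup_on S m \<and> topspace T = S \<and>
     continuous_map (prod_topology T T) T (\<lambda>(x, y). m x y) \<and>
     continuous_map T T (semigroup_inverse S m)"

definition Tychonoff_space :: "'s topology \<Rightarrow> bool" where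
  "Tychonoff_space T \<longleftrightarrow> completely_regular_space T \<and> Hausdorff_space T"


section \<open>Partial one-to-one maps\<close>

text \<open>An arbitrary set \<open>L\<close> plays the role of the cardinal: everything below depends only on
  the underlying set.\<close>

definition sym_inv_semigroup :: "'a set \<Rightarrow> ('a \<rightharpoonup> 'a) set" where
  "sym_inv_semigroup L = {\<alpha>. dom \<alpha> \<subseteq> L \<and> ran \<alpha> \<subseteq> L \<and> inj_on \<alpha> (dom \<alpha>)}"

text \<open>Left-to-right composition: \<open>pcomp \<alpha> \<beta>\<close> applies \<open>\<alpha>\<close> first.\<close>

definition pcomp :: "('a \<rightharpoonup> 'a) \<Rightarrow> ('a \<rightharpoonup> 'a) \<Rightarrow> ('a \<rightharpoonup> 'a)" where
  "pcomp \<alpha> \<beta> = \<beta> \<circ>\<^sub>m \<alpha>"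

definition almost_identity :: "'a set \<Rightarrow> ('a \<rightharpoonup> 'a) \<Rightarrow> bool" where
  "almost_identity L \<alpha> \<longleftrightarrow> finite (L - dom \<alpha>) \<and> finite {x \<in> dom \<alpha>. \<alpha> x \<noteq> Some x}"

definition I_infty :: "'a set \<Rightarrow> ('a \<rightharpoonup> 'a) set" where
  "I_infty L = {\<alpha> \<in> sym_inv_semigroup L. almost_identity L \<alpha>}"


section \<open>The topology\<close>

definition U_nbhd :: "'a set \<Rightarrow> ('a \<rightharpoonup> 'a) \<Rightarrow> 'a set \<Rightarrow> ('a \<rightharpoonup> 'a) set" where
  "U_nbhd L \<alpha> F =
     {\<beta> \<in> I_infty L. dom \<alpha> = dom \<beta> \<and> ran \<alpha> = ran \<beta> \<and> (\<forall>x\<in>F. \<beta> x = \<alpha> x)}"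

definition B_F :: "'a set \<Rightarrow> ('a \<rightharpoonup> 'a) \<Rightarrow> ('a \<rightharpoonup> 'a) set set" where
  "B_F L \<alpha> = {U_nbhd L \<alpha> F | F. finite F \<and> F \<subseteq> dom \<alpha>}"

definition tau_F :: "'a set \<Rightarrow> ('a \<rightharpoonup> 'a) topology" where
  "tau_F L = topology (\<lambda>W. W \<subseteq> I_infty L \<and> (\<forall>\<alpha>\<in>W. \<exists>U \<in> B_F L \<alpha>. U \<subseteq> W))"

text \<open>\<open>tau_F L\<close> is the unique topology on \<open>I_infty L\<close> for which every \<open>B_F L \<alpha>\<close> is a base of
  open neighbourhoods at \<open>\<alpha>\<close>.\<close>

lemma openin_tau_F:
  "openin (tau_F L) W \<longleftrightarrow> W \<subseteq> I_infty L \<and> (\<forall>\<alpha>\<in>W. \<exists>U \<in> B_F L \<alpha>. U \<subseteq> W)"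
proof -
  have "istopology (\<lambda>W. W \<subseteq> I_infty L \<and> (\<forall>\<alpha>\<in>W. \<exists>U \<in> B_F L \<alpha>. U \<subseteq> W))"
    unfolding istopology_def
  proof (intro conjI allI impI ballI)
    fix S T \<alpha>
    assume S: "S \<subseteq> I_infty L \<and> (\<forall>\<alpha>\<in>S. \<exists>U \<in> B_F L \<alpha>. U \<subseteq> S)"
      and T: "T \<subseteq> I_infty L \<and> (\<forall>\<alpha>\<in>T. \<exists>U \<in> B_F L \<alpha>. U \<subseteq> T)"
      and \<alpha>: "\<alpha> \<in> S \<inter> T"
    obtain F where F: "finite F" "F \<subseteq> dom \<alpha>" "U_nbhd L \<alpha> F \<subseteq> S"
      using S \<alpha> unfolding B_F_def by blast
    obtain G where G: "finite G" "G \<subseteq> dom \<alpha>" "U_nbhd L \<alpha> G \<subseteq> T"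
      using T \<alpha> unfolding B_F_def by blast
    have "U_nbhd L \<alpha> (F \<union> G) \<subseteq> S \<inter> T"
      using F(3) G(3) unfolding U_nbhd_def by blast
    moreover have "U_nbhd L \<alpha> (F \<union> G) \<in> B_F L \<alpha>"
      using F G unfolding B_F_def by blast
    ultimately show "\<exists>U \<in> B_F L \<alpha>. U \<subseteq> S \<inter> T" by blast
  next
    fix \<K> \<alpha>
    assume "\<forall>K\<in>\<K>. K \<subseteq> I_infty L \<and> (\<forall>\<alpha>\<in>K. \<exists>U \<in> B_F L \<alpha>. U \<subseteq> K)" "\<alpha> \<in> \<Union>\<K>"
    then show "\<exists>U \<in> B_F L \<alpha>. U \<subseteq> \<Union>\<K>" by (meson UnionE Union_upper order_trans)
  qed blast+
  then show ?thesis by (simp add: tau_F_def)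
qed

lemma openin_U_nbhd: "U \<in> B_F L \<alpha> \<Longrightarrow> openin (tau_F L) U"
proof -
  assume "U \<in> B_F L \<alpha>"
  then obtain F where F: "finite F" "F \<subseteq> dom \<alpha>" "U = U_nbhd L \<alpha> F"
    unfolding B_F_def by blast
  have "\<exists>V \<in> B_F L \<beta>. V \<subseteq> U" if "\<beta> \<in> U" for \<beta>
  proof
    have "F \<subseteq> dom \<beta>" using F that unfolding U_nbhd_def by simp
    then show "U_nbhd L \<beta> F \<in> B_F L \<beta>" using F(1) unfolding B_F_def by blast
    show "U_nbhd L \<beta> F \<subseteq> U"
      using F that unfolding U_nbhd_def by auto
  qed
  moreover have "U \<subseteq> I_infty L" using F unfolding U_nbhd_def by auto
  ultimately show ?thesis by (simp add: openin_tau_F)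
qed

lemma topspace_tau_F: "topspace (tau_F L) = I_infty L"
proof
  show "topspace (tau_F L) \<subseteq> I_infty L"
    unfolding topspace_def by (auto simp: openin_tau_F)
  have "openin (tau_F L) (I_infty L)"
    unfolding openin_tau_F
  proof (intro conjI ballI subset_refl)
    fix \<alpha> :: "'a \<rightharpoonup> 'a"
    have "U_nbhd L \<alpha> {} \<in> B_F L \<alpha>" unfolding B_F_def by blast
    moreover have "U_nbhd L \<alpha> {} \<subseteq> I_infty L" unfolding U_nbhd_def by blast
    ultimately show "\<exists>U \<in> B_F L \<alpha>. U \<subseteq> I_infty L" by blast
  qed
  then show "I_infty L \<subseteq> topspace (tau_F L)" by (rule openin_subset)
qed

lemma tau_F_nbhd_base:
  assumes "\<alpha> \<in> I_infty L"
  shows "\<And>U. U \<in> B_F L \<alpha> \<Longrightarrow> openin (tau_F L) U \<and> \<alpha> \<in> U"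
    and "\<And>W. openin (tau_F L) W \<Longrightarrow> \<alpha> \<in> W \<Longrightarrow> \<exists>U \<in> B_F L \<alpha>. U \<subseteq> W"
proof -
  fix U assume U: "U \<in> B_F L \<alpha>"
  then obtain F where "U = U_nbhd L \<alpha> F" unfolding B_F_def by blast
  then have "\<alpha> \<in> U" using assms by (simp add: U_nbhd_def)
  then show "openin (tau_F L) U \<and> \<alpha> \<in> U" using openin_U_nbhd[OF U] by simp
next
  fix W assume "openin (tau_F L) W" "\<alpha> \<in> W"
  then show "\<exists>U \<in> B_F L \<alpha>. U \<subseteq> W" by (simp add: openin_tau_F)
qed

lemma tau_F_unique:
  assumes "topspace T = I_infty L"
    and "\<And>\<alpha> U. \<alpha> \<in> I_infty L \<Longrightarrow> U \<in> B_F L \<alpha> \<Longrightarrow> openin T U \<and> \<alpha> \<in> U"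
    and "\<And>\<alpha> W. openin T W \<Longrightarrow> \<alpha> \<in> W \<Longrightarrow> \<exists>U \<in> B_F L \<alpha>. U \<subseteq> W"
  shows "T = tau_F L"
proof -
  have "openin T W" if W: "W \<subseteq> I_infty L" "\<forall>\<alpha>\<in>W. \<exists>U \<in> B_F L \<alpha>. U \<subseteq> W" for W
  proof (subst openin_subopen, intro ballI)
    fix \<alpha> assume \<alpha>: "\<alpha> \<in> W"
    then obtain U where "U \<in> B_F L \<alpha>" "U \<subseteq> W" using W(2) by blast
    then show "\<exists>U. openin T U \<and> \<alpha> \<in> U \<and> U \<subseteq> W" using assms(2) W(1) \<alpha> by blast
  qed
  moreover have "W \<subseteq> I_infty L" if "openin T W" for W
    using openin_subset[OF that] assms(1) by simp
  ultimately have "openin T W \<longleftrightarrow> openin (tau_F L) W" for W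
    unfolding openin_tau_F by (metis assms(3))
  then show ?thesis by (simp add: topology_eq)
qed

end

(* Every U_nbhd L \<alpha> F is clopen, which gives complete regularity and the Hausdorff property. For the
   product, choose the finite control set large enough to contain the points x of dom \<alpha> with \<alpha> x
   outside dom \<beta>, and the points of dom \<beta> outside ran \<alpha>; both sets are finite because \<alpha> and \<beta> are
   almost the identity. Fixing the values there fixes the domain and the range of the product, since
   the domains, the ranges and injectivity of the factors are preserved. *)
theory Submission
  imports Defs
begin

section \<open>The inverse semigroup of partial injections that are almost the identity\<close>

lemma I_infty_iff:
  "\<alpha> \<in> I_infty L \<longleftrightarrow>
     dom \<alpha> \<subseteq> L \<and> ran \<alpha> \<subseteq> L \<and> (\<forall>x y z. \<alpha> x = Some z \<longrightarrow> \<alpha> y = Some z \<longrightarrow> x = y) \<and>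
     finite {x \<in> L. \<alpha> x \<noteq> Some x}"
proof -
  have "inj_on \<alpha> (dom \<alpha>) \<longleftrightarrow> (\<forall>x y z. \<alpha> x = Some z \<longrightarrow> \<alpha> y = Some z \<longrightarrow> x = y)"
    by (auto simp: inj_on_def dom_def)
  \<comment> \<open>A point of \<open>L\<close> outside the domain has value \<open>None\<close>,
    which differs from \<open>Some x\<close>, so one set collects the missing points and the moved
    points.\<close>
  moreover have "{x \<in> L. \<alpha> x \<noteq> Some x} = (L - dom \<alpha>) \<union> {x \<in> dom \<alpha>. \<alpha> x \<noteq> Some x}" if "dom \<alpha> \<subseteq> L"
    using that by auto
  ultimately show ?thesis
    by (auto simp: I_infty_def sym_inv_semigroup_def almost_identity_def)
qed

lemma I_infty_inj:
  "\<alpha> \<in> I_infty L \<Longrightarrow> \<alpha> x = Some z \<Longrightarrow> \<alpha> y = Some z \<Longrightarrow> x = y"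
  by (meson I_infty_iff)

lemma finite_diff_dom: "\<alpha> \<in> I_infty L \<Longrightarrow> finite (L - dom \<alpha>)"
  unfolding I_infty_iff by (auto elim!: rev_finite_subset)

text \<open>A point missed by the range cannot be fixed, so it is one of the finitely many
  exceptional points.\<close>

lemma finite_diff_ran: "\<alpha> \<in> I_infty L \<Longrightarrow> finite (L - ran \<alpha>)"
  unfolding I_infty_iff by (auto elim!: rev_finite_subset intro: ranI)

lemma pcomp_eq_Some: "pcomp \<alpha> \<beta> x = Some z \<longleftrightarrow> (\<exists>y. \<alpha> x = Some y \<and> \<beta> y = Some z)"
  by (auto simp: pcomp_def map_comp_def split: option.splits)

lemma pcomp_assoc: "pcomp (pcomp \<alpha> \<beta>) \<gamma> = pcomp \<alpha> (pcomp \<beta> \<gamma>)"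
  by (auto simp: pcomp_def map_comp_def split: option.splits)

lemma pcomp_in_I_infty:
  assumes "\<alpha> \<in> I_infty L" "\<beta> \<in> I_infty L"
  shows "pcomp \<alpha> \<beta> \<in> I_infty L"
proof -
  \<comment> \<open>A point fixed by both factors is fixed by the product.\<close>
  have "{x \<in> L. pcomp \<alpha> \<beta> x \<noteq> Some x} \<subseteq> {x \<in> L. \<alpha> x \<noteq> Some x} \<union> {x \<in> L. \<beta> x \<noteq> Some x}"
    by (auto simp: pcomp_eq_Some)
  then have "finite {x \<in> L. pcomp \<alpha> \<beta> x \<noteq> Some x}"
    using assms unfolding I_infty_iff by (meson finite_UnI finite_subset)
  moreover have "dom (pcomp \<alpha> \<beta>) \<subseteq> dom \<alpha>" "ran (pcomp \<alpha> \<beta>) \<subseteq> ran \<beta>"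
    by (auto simp: pcomp_eq_Some dom_def ran_def)
  moreover have "x = y" if "pcomp \<alpha> \<beta> x = Some z" "pcomp \<alpha> \<beta> y = Some z" for x y z
    using that I_infty_inj[OF assms(1)] I_infty_inj[OF assms(2)] by (fastforce simp: pcomp_eq_Some)
  moreover have "dom \<alpha> \<subseteq> L" "ran \<beta> \<subseteq> L"
    using assms by (simp_all add: I_infty_iff)
  ultimately show ?thesis
    unfolding I_infty_iff by (intro conjI allI impI) (assumption | erule (1) subset_trans | blast)+
qed

text \<open>The converse partial map, with the preimage picked by choice; for injective \<alpha>
  there is only one candidate, hence the membership hypotheses in the lemmas below.\<close>

definition pinv :: "('a \<rightharpoonup> 'a) \<Rightarrow> ('a \<rightharpoonup> 'a)" where
  "pinv \<alpha> y = (if y \<in> ran \<alpha> then Some (SOME x. \<alpha> x = Some y) else None)"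

lemma pinv_eq_Some:
  assumes "\<alpha> \<in> I_infty L"
  shows "pinv \<alpha> y = Some x \<longleftrightarrow> \<alpha> x = Some y"
proof -
  have "(SOME x. \<alpha> x = Some y) = x" if "\<alpha> x = Some y" for x
    using that assms by (metis (mono_tags, lifting) I_infty_inj someI)
  then show ?thesis
    by (auto simp: pinv_def ran_def)
qed

lemma dom_pinv: "\<alpha> \<in> I_infty L \<Longrightarrow> dom (pinv \<alpha>) = ran \<alpha>"
  by (auto simp: dom_def ran_def pinv_eq_Some)

lemma ran_pinv: "\<alpha> \<in> I_infty L \<Longrightarrow> ran (pinv \<alpha>) = dom \<alpha>"
  by (auto simp: dom_def ran_def pinv_eq_Some)

text \<open>A partial injection and its converse fix the same points, so their exceptional sets in
  \<open>L\<close> coincide.\<close>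

lemma pinv_in_I_infty:
  assumes "\<alpha> \<in> I_infty L"
  shows "pinv \<alpha> \<in> I_infty L"
  using assms unfolding I_infty_iff[of "pinv \<alpha>"]
  by (auto simp: dom_pinv ran_pinv pinv_eq_Some) (auto simp: I_infty_iff)

text \<open>Each of the two inverse equations yields one inclusion between \<beta> and the converse
  of \<alpha>, as graphs. The equivalence gives existence and uniqueness of inverses together, and
  also evaluates the description operator in \<open>semigroup_inverse\<close>.\<close>

lemma is_inverse_of_pcomp_iff:
  assumes "\<alpha> \<in> I_infty L" "\<beta> \<in> I_infty L"
  shows "is_inverse_of pcomp \<alpha> \<beta> \<longleftrightarrow> \<beta> = pinv \<alpha>"
proof
  assume inv: "is_inverse_of pcomp \<alpha> \<beta>"
  have eq: "pcomp (pcomp \<alpha> \<beta>) \<alpha> = \<alpha>" "pcomp (pcomp \<beta> \<alpha>) \<beta> = \<beta>"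
    using inv by (auto simp: is_inverse_of_def)
  have "\<beta> y = Some x" if xy: "\<alpha> x = Some y" for x y
  proof -
    have "pcomp (pcomp \<alpha> \<beta>) \<alpha> x = Some y" using xy eq(1) by simp
    \<comment> \<open>The triple product runs from \<open>x\<close> to \<open>y\<close>, on to
      \<open>z\<close> by \<beta>, and back to \<open>y\<close>; injectivity of \<alpha> identifies
      \<open>z\<close> with \<open>x\<close>.\<close>
    then obtain z where z: "\<beta> y = Some z" "\<alpha> z = Some y"
      by (auto simp: pcomp_eq_Some xy)
    then show ?thesis using I_infty_inj[OF assms(1) z(2) xy] by simp
  qed
  moreover have "\<alpha> x = Some y" if xy: "\<beta> y = Some x" for x y
  proof -
    have "pcomp (pcomp \<beta> \<alpha>) \<beta> y = Some x" using xy eq(2) by simp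
    then obtain z where z: "\<alpha> x = Some z" "\<beta> z = Some x"
      by (auto simp: pcomp_eq_Some xy)
    then show ?thesis using I_infty_inj[OF assms(2) z(2) xy] by simp
  qed
  ultimately have "\<beta> y = Some x \<longleftrightarrow> pinv \<alpha> y = Some x" for x y
    using pinv_eq_Some[OF assms(1)] by blast
  then show "\<beta> = pinv \<alpha>"
    by (intro ext) (metis option.exhaust)
next
  assume "\<beta> = pinv \<alpha>"
  then have "pcomp (pcomp \<alpha> \<beta>) \<alpha> x = Some y \<longleftrightarrow> \<alpha> x = Some y"
    "pcomp (pcomp \<beta> \<alpha>) \<beta> x = Some y \<longleftrightarrow> \<beta> x = Some y" for x y
    using assms(1) by (auto simp: pcomp_eq_Some pinv_eq_Some dest: I_infty_inj)
  then show "is_inverse_of pcomp \<alpha> \<beta>"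
    unfolding is_inverse_of_def by (intro conjI ext) (metis option.exhaust)+
qed

lemma inverse_semigroup_I_infty: "inverse_semigroup_on (I_infty L) pcomp"
  unfolding inverse_semigroup_on_def semigroup_on_def
  by (auto simp: pcomp_in_I_infty pcomp_assoc is_inverse_of_pcomp_iff pinv_in_I_infty
      intro!: ex1I[of _ "pinv _"])

lemma semigroup_inverse_I_infty:
  assumes "\<alpha> \<in> I_infty L"
  shows "semigroup_inverse (I_infty L) pcomp \<alpha> = pinv \<alpha>"
  unfolding semigroup_inverse_def
  using assms by (intro the_equality) (auto simp: is_inverse_of_pcomp_iff pinv_in_I_infty)

section \<open>Clopen basic neighbourhoods and the separation axioms\<close>

lemma U_nbhd_self: "\<alpha> \<in> I_infty L \<Longrightarrow> \<alpha> \<in> U_nbhd L \<alpha> F"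
  by (simp add: U_nbhd_def)

lemma openin_U_nbhd_finite: "finite F \<Longrightarrow> F \<subseteq> dom \<alpha> \<Longrightarrow> openin (tau_F L) (U_nbhd L \<alpha> F)"
  by (rule openin_U_nbhd) (auto simp: B_F_def)

lemma openin_tau_FE:
  assumes "openin (tau_F L) W" "\<alpha> \<in> W"
  obtains F where "finite F" "F \<subseteq> dom \<alpha>" "U_nbhd L \<alpha> F \<subseteq> W"
  using assms unfolding openin_tau_F B_F_def by blast

text \<open>A map \<beta> outside the neighbourhood violates one of its conditions, and a
  neighbourhood of \<beta> preserves this violation: the empty control set suffices for a wrong
  domain or range, a single point for a wrong value.\<close>

lemma closedin_U_nbhd:
  assumes "F \<subseteq> dom \<alpha>"
  shows "closedin (tau_F L) (U_nbhd L \<alpha> F)"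
  unfolding closedin_def topspace_tau_F
proof
  show "U_nbhd L \<alpha> F \<subseteq> I_infty L" by (auto simp: U_nbhd_def)
  show "openin (tau_F L) (I_infty L - U_nbhd L \<alpha> F)"
    unfolding openin_tau_F
  proof (intro conjI ballI)
    fix \<beta> assume \<beta>: "\<beta> \<in> I_infty L - U_nbhd L \<alpha> F"
    obtain G where G: "finite G" "G \<subseteq> dom \<beta>" "U_nbhd L \<beta> G \<inter> U_nbhd L \<alpha> F = {}"
    proof (cases "dom \<beta> = dom \<alpha> \<and> ran \<beta> = ran \<alpha>")
      case True
      then obtain x where "x \<in> F" "\<beta> x \<noteq> \<alpha> x"
        using \<beta> by (auto simp: U_nbhd_def)
      \<comment> \<open>Since \<open>F\<close> lies in the common domain, \<open>{x}\<close> is an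
        admissible control set at \<beta>.\<close>
      with True assms show thesis
        by (intro that[of "{x}"]) (auto simp: U_nbhd_def)
    next
      case False
      then show thesis
        by (intro that[of "{}"]) (simp_all add: U_nbhd_def disjoint_iff, metis)
    qed
    have "U_nbhd L \<beta> G \<subseteq> I_infty L - U_nbhd L \<alpha> F"
      using G(3) by (auto simp: U_nbhd_def)
    with G(1,2) show "\<exists>U\<in>B_F L \<beta>. U \<subseteq> I_infty L - U_nbhd L \<alpha> F"
      unfolding B_F_def by blast
  qed blast
qed

text \<open>The separating function is the indicator of the complement of a clopen neighbourhood
  that avoids \<open>C\<close>.\<close>

lemma completely_regular_tau_F: "completely_regular_space (tau_F L)"
  unfolding completely_regular_space_def
proof (intro allI impI)
  fix C \<alpha> assume C: "closedin (tau_F L) C \<and> \<alpha> \<in> topspace (tau_F L) - C"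
  have "openin (tau_F L) (topspace (tau_F L) - C)"
    using C by blast
  then obtain F where F: "finite F" "F \<subseteq> dom \<alpha>" "U_nbhd L \<alpha> F \<subseteq> topspace (tau_F L) - C"
    using C by (auto elim: openin_tau_FE)
  let ?U = "U_nbhd L \<alpha> F"
  let ?f = "\<lambda>\<beta>. if \<beta> \<in> ?U then 0 else 1 :: real"
  have "continuous_map (tau_F L) (top_of_set {0..1}) ?f"
    unfolding continuous_map_def
  proof (intro conjI allI impI)
    fix W :: "real set"
    \<comment> \<open>The preimage depends only on which of 0 and 1 belong to \<open>W\<close>; each
      possible piece is open because \<open>?U\<close> is clopen.\<close>
    have "{\<beta> \<in> topspace (tau_F L). ?f \<beta> \<in> W} =
        (if 0 \<in> W then ?U else {}) \<union> (if 1 \<in> W then topspace (tau_F L) - ?U else {})"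
      using F(3) by auto
    then show "openin (tau_F L) {\<beta> \<in> topspace (tau_F L). ?f \<beta> \<in> W}"
      using openin_U_nbhd_finite[OF F(1,2)] closedin_U_nbhd[OF F(2)]
      by (auto intro!: openin_Un openin_diff)
  qed auto
  moreover have "?f \<alpha> = 0"
    using C U_nbhd_self by (auto simp: topspace_tau_F)
  moreover have "?f ` C \<subseteq> {1}"
    using F(3) by auto
  ultimately show "\<exists>f. continuous_map (tau_F L) (top_of_set {0..1::real}) f \<and> f \<alpha> = 0 \<and> f ` C \<subseteq> {1}"
    by blast
qed

text \<open>It suffices to find a basic neighbourhood of \<alpha> that misses \<beta>; its
  complement is then an open neighbourhood of \<beta>.\<close>

lemma Hausdorff_tau_F: "Hausdorff_space (tau_F L)"
  unfolding Hausdorff_space_def topspace_tau_F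
proof (intro allI impI)
  fix \<alpha> \<beta> assume *: "\<alpha> \<in> I_infty L \<and> \<beta> \<in> I_infty L \<and> \<alpha> \<noteq> \<beta>"
  obtain F where F: "finite F" "F \<subseteq> dom \<alpha>" "\<beta> \<notin> U_nbhd L \<alpha> F"
  proof (cases "dom \<alpha> = dom \<beta>")
    case True
    \<comment> \<open>Such an \<open>x\<close> lies in the common domain, since outside it both
      values are \<open>None\<close>.\<close>
    obtain x where "\<alpha> x \<noteq> \<beta> x" using * by blast
    with True show thesis
      by (intro that[of "{x}"]) (auto simp: U_nbhd_def domIff)
  next
    case False
    then show thesis
      by (intro that[of "{}"]) (auto simp: U_nbhd_def)
  qed
  have "openin (tau_F L) (I_infty L - U_nbhd L \<alpha> F)"
    using closedin_U_nbhd[OF F(2), of L] by (simp add: closedin_def topspace_tau_F)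
  with F * openin_U_nbhd_finite[OF F(1,2)] U_nbhd_self
  show "\<exists>U V. openin (tau_F L) U \<and> openin (tau_F L) V \<and> \<alpha> \<in> U \<and> \<beta> \<in> V \<and> disjnt U V"
    by (intro exI[of _ "U_nbhd L \<alpha> F"] exI[of _ "I_infty L - U_nbhd L \<alpha> F"]) (auto simp: disjnt_def)
qed

section \<open>Continuity of multiplication and inversion\<close>

lemma continuous_map_tau_FI:
  assumes "f \<in> topspace X \<rightarrow> I_infty L"
    and "\<And>x F. x \<in> topspace X \<Longrightarrow> finite F \<Longrightarrow> F \<subseteq> dom (f x) \<Longrightarrow>
           \<exists>V. openin X V \<and> x \<in> V \<and> f ` V \<subseteq> U_nbhd L (f x) F"
  shows "continuous_map X (tau_F L) f"
  unfolding continuous_map_def topspace_tau_F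
proof (intro conjI allI impI assms(1))
  fix W assume W: "openin (tau_F L) W"
  show "openin X {x \<in> topspace X. f x \<in> W}"
  \<comment> \<open>Openness of the preimage is checked pointwise, which reduces continuity to the
    basic neighbourhoods of \<open>f x\<close>.\<close>
  proof (subst openin_subopen, clarify)
    fix x assume x: "x \<in> topspace X" "f x \<in> W"
    obtain F where F: "finite F" "F \<subseteq> dom (f x)" "U_nbhd L (f x) F \<subseteq> W"
      using W x(2) by (rule openin_tau_FE)
    then obtain V where V: "openin X V" "x \<in> V" "f ` V \<subseteq> U_nbhd L (f x) F"
      using assms(2)[OF x(1) F(1,2)] by blast
    then have "V \<subseteq> {x \<in> topspace X. f x \<in> W}"
      using F(3) openin_subset[OF V(1)] by blast
    with V show "\<exists>T. openin X T \<and> x \<in> T \<and> T \<subseteq> {x \<in> topspace X. f x \<in> W}"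
      by blast
  qed
qed

text \<open>The points that \<alpha> sends outside \<open>dom \<beta>\<close> keep their images
  under \<open>\<alpha>'\<close>. As the ranges agree, these images are already all values of
  \<open>\<alpha>'\<close> outside \<open>dom \<beta>\<close>, so by injectivity no other point is
  sent there.\<close>

lemma dom_pcomp_eq:
  assumes "\<alpha> \<in> I_infty L" and \<alpha>': "\<alpha>' \<in> U_nbhd L \<alpha> {x \<in> dom \<alpha>. the (\<alpha> x) \<notin> dom \<beta>}"
    and "dom \<beta>' = dom \<beta>"
  shows "dom (pcomp \<alpha>' \<beta>') = dom (pcomp \<alpha> \<beta>)"
proof -
  have \<alpha>'I: "\<alpha>' \<in> I_infty L" and dom: "dom \<alpha>' = dom \<alpha>" and ran: "ran \<alpha>' = ran \<alpha>"
    and eq: "\<And>x y. \<alpha> x = Some y \<Longrightarrow> y \<notin> dom \<beta> \<Longrightarrow> \<alpha>' x = Some y"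
    using \<alpha>' by (auto simp: U_nbhd_def)
  have dom_pcomp: "x \<in> dom (pcomp \<gamma> \<delta>) \<longleftrightarrow> (\<exists>y. \<gamma> x = Some y \<and> y \<in> dom \<delta>)" for x and \<gamma> \<delta> :: "'a \<rightharpoonup> 'a"
    by (auto simp: dom_def pcomp_eq_Some)
  have "y \<in> dom \<beta> \<longleftrightarrow> y' \<in> dom \<beta>" if y: "\<alpha> x = Some y" "\<alpha>' x = Some y'" for x y y'
  proof
    assume yd: "y \<in> dom \<beta>"
    show "y' \<in> dom \<beta>"
    proof (rule ccontr)
      assume y'd: "y' \<notin> dom \<beta>"
      have "y' \<in> ran \<alpha>" using y(2) ran by (blast intro: ranI)
      then obtain z where z: "\<alpha> z = Some y'" by (auto simp: ran_def)
      \<comment> \<open>The value of \<alpha> at \<open>z\<close> lies outside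
        \<open>dom \<beta>\<close>, so \<open>\<alpha>'\<close> takes it at \<open>z\<close> as well
        as at \<open>x\<close>.\<close>
      then have "z = x" using I_infty_inj[OF \<alpha>'I eq[OF z y'd] y(2)] by simp
      then show False using z y(1) yd y'd by simp
    qed
  next
    assume "y' \<in> dom \<beta>"
    then show "y \<in> dom \<beta>" using eq[OF y(1)] y(2) by force
  qed
  moreover have "(\<exists>y. \<alpha> x = Some y) \<longleftrightarrow> (\<exists>y. \<alpha>' x = Some y)" for x
    using dom by (metis domD domI)
  ultimately show ?thesis
    unfolding set_eq_iff dom_pcomp assms(3) by metis
qed

text \<open>A value \<open>z\<close> is attained by the product iff its preimage under the second
  factor lies in the range of the first. Replacing \<beta> by \<open>\<beta>'\<close> may move this
  preimage, but if the old or the new one is outside \<open>ran \<alpha>\<close>, both maps agree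
  there and injectivity makes the two preimages equal.\<close>

lemma ran_pcomp_eq:
  assumes "\<beta> \<in> I_infty L" and \<beta>': "\<beta>' \<in> U_nbhd L \<beta> (dom \<beta> - ran \<alpha>)"
    and "ran \<alpha>' = ran \<alpha>"
  shows "ran (pcomp \<alpha>' \<beta>') = ran (pcomp \<alpha> \<beta>)"
proof -
  have \<beta>'I: "\<beta>' \<in> I_infty L" and dom: "dom \<beta>' = dom \<beta>" and ran: "ran \<beta>' = ran \<beta>"
    and eq: "\<And>y. y \<in> dom \<beta> \<Longrightarrow> y \<notin> ran \<alpha> \<Longrightarrow> \<beta>' y = \<beta> y"
    using \<beta>' by (auto simp: U_nbhd_def)
  have ran_pcomp: "z \<in> ran (pcomp \<gamma> \<delta>) \<longleftrightarrow> (\<exists>y. \<delta> y = Some z \<and> y \<in> ran \<gamma>)" for z and \<gamma> \<delta> :: "'a \<rightharpoonup> 'a"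
    by (auto simp: ran_def pcomp_eq_Some)
  have "y \<in> ran \<alpha> \<longleftrightarrow> y' \<in> ran \<alpha>" if "\<beta> y = Some z" "\<beta>' y' = Some z" for y y' z
    using that eq[of y] eq[of y'] dom I_infty_inj[OF assms(1)] I_infty_inj[OF \<beta>'I] by (metis domI)
  moreover have "(\<exists>y. \<beta> y = Some z) \<longleftrightarrow> (\<exists>y. \<beta>' y = Some z)" for z
    using ran by (auto simp: ran_def set_eq_iff)
  ultimately show ?thesis
    unfolding set_eq_iff ran_pcomp assms(3) by metis
qed

lemma finite_vimage_I_infty:
  assumes "\<alpha> \<in> I_infty L" "finite A"
  shows "finite {x \<in> dom \<alpha>. the (\<alpha> x) \<in> A}"
proof -
  \<comment> \<open>Points of \<open>A\<close> outside the range contribute only the arbitrary value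
    \<open>the None\<close>, which is harmless for an inclusion.\<close>
  have "{x \<in> dom \<alpha>. the (\<alpha> x) \<in> A} \<subseteq> (\<lambda>y. the (pinv \<alpha> y)) ` A"
  proof clarify
    fix x y assume "the (\<alpha> x) \<in> A" "\<alpha> x = Some y"
    then show "x \<in> (\<lambda>y. the (pinv \<alpha> y)) ` A"
      using pinv_eq_Some[OF assms(1), of y x] by force
  qed
  then show ?thesis using assms(2) by (meson finite_imageI finite_subset)
qed

lemma continuous_map_pcomp:
  "continuous_map (prod_topology (tau_F L) (tau_F L)) (tau_F L) (\<lambda>(\<alpha>, \<beta>). pcomp \<alpha> \<beta>)"
proof (rule continuous_map_tau_FI)
  show "(\<lambda>(\<alpha>, \<beta>). pcomp \<alpha> \<beta>) \<in> topspace (prod_topology (tau_F L) (tau_F L)) \<rightarrow> I_infty L"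
    by (auto simp: topspace_tau_F pcomp_in_I_infty)
next
  fix p F
  assume "p \<in> topspace (prod_topology (tau_F L) (tau_F L))"
    and F: "finite F" "F \<subseteq> dom (case p of (\<alpha>, \<beta>) \<Rightarrow> pcomp \<alpha> \<beta>)"
  then obtain \<alpha> \<beta> where p: "p = (\<alpha>, \<beta>)" and \<alpha>: "\<alpha> \<in> I_infty L" and \<beta>: "\<beta> \<in> I_infty L"
    by (auto simp: topspace_tau_F)
  have F_sub: "\<exists>y. \<alpha> x = Some y \<and> y \<in> dom \<beta>" if "x \<in> F" for x
    using F(2) that by (force simp: p dom_def pcomp_eq_Some)
  define A where "A = {x \<in> dom \<alpha>. the (\<alpha> x) \<notin> dom \<beta>}"
  define B where "B = dom \<beta> - ran \<alpha>"
  \<comment> \<open>\<open>A\<close> and \<open>B\<close> are the control sets for domain and range.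
    Adding \<open>F\<close> to the first and its image under \<alpha> to the second preserves both
    steps of the evaluation of the product on \<open>F\<close>.\<close>
  define G where "G = F \<union> A"
  define H where "H = (\<lambda>x. the (\<alpha> x)) ` F \<union> B"
  \<comment> \<open>Because the range of \<alpha> lies in \<open>L\<close>, \<open>A\<close> is
    contained in the preimage of the finite set \<open>L - dom \<beta>\<close>.\<close>
  have "A \<subseteq> {x \<in> dom \<alpha>. the (\<alpha> x) \<in> L - dom \<beta>}"
    using \<alpha> by (force simp: A_def I_infty_iff intro: ranI)
  then have "finite A"
    using finite_vimage_I_infty[OF \<alpha> finite_diff_dom[OF \<beta>]] finite_subset by blast
  moreover have "B \<subseteq> L - ran \<alpha>"
    using \<beta> by (auto simp: B_def I_infty_iff)
  then have "finite B"
    using finite_diff_ran[OF \<alpha>] finite_subset by blast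
  ultimately have fin: "finite G" "finite H"
    using F(1) by (auto simp: G_def H_def)
  have "F \<subseteq> dom \<alpha>"
    using F_sub by blast
  moreover have "(\<lambda>x. the (\<alpha> x)) ` F \<subseteq> dom \<beta>"
    using F_sub by (metis image_subsetI option.sel)
  ultimately have sub: "G \<subseteq> dom \<alpha>" "H \<subseteq> dom \<beta>"
    by (simp_all add: G_def A_def H_def B_def Collect_restrict)
  have "pcomp \<alpha>' \<beta>' \<in> U_nbhd L (pcomp \<alpha> \<beta>) F"
    if \<alpha>': "\<alpha>' \<in> U_nbhd L \<alpha> G" and \<beta>': "\<beta>' \<in> U_nbhd L \<beta> H" for \<alpha>' \<beta>'
  proof -
    have "pcomp \<alpha>' \<beta>' x = pcomp \<alpha> \<beta> x" if x: "x \<in> F" for x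
    proof -
      obtain y where y: "\<alpha> x = Some y" using F_sub x by blast
      have "\<alpha>' x = \<alpha> x" using \<alpha>' x by (simp add: U_nbhd_def G_def)
      moreover have "y \<in> H" using y x by (force simp: H_def)
      then have "\<beta>' y = \<beta> y" using \<beta>' by (simp add: U_nbhd_def)
      ultimately show ?thesis using y by (simp add: pcomp_def map_comp_def)
    qed
    moreover have "dom (pcomp \<alpha>' \<beta>') = dom (pcomp \<alpha> \<beta>)"
      using \<alpha>' \<beta>' by (intro dom_pcomp_eq[OF \<alpha>]) (auto simp: U_nbhd_def G_def A_def)
    moreover have "ran (pcomp \<alpha>' \<beta>') = ran (pcomp \<alpha> \<beta>)"
      using \<alpha>' \<beta>' by (intro ran_pcomp_eq[OF \<beta>]) (auto simp: U_nbhd_def H_def B_def)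
    ultimately show ?thesis
      using \<alpha>' \<beta>' by (auto simp: U_nbhd_def pcomp_in_I_infty)
  qed
  then have "(\<lambda>(\<alpha>, \<beta>). pcomp \<alpha> \<beta>) ` (U_nbhd L \<alpha> G \<times> U_nbhd L \<beta> H) \<subseteq> U_nbhd L (pcomp \<alpha> \<beta>) F"
    by auto
  moreover have "openin (prod_topology (tau_F L) (tau_F L)) (U_nbhd L \<alpha> G \<times> U_nbhd L \<beta> H)"
    using fin sub by (simp add: openin_prod_Times_iff openin_U_nbhd_finite)
  ultimately show "\<exists>V. openin (prod_topology (tau_F L) (tau_F L)) V \<and> p \<in> V \<and>
      (\<lambda>(\<alpha>, \<beta>). pcomp \<alpha> \<beta>) ` V \<subseteq> U_nbhd L (case p of (\<alpha>, \<beta>) \<Rightarrow> pcomp \<alpha> \<beta>) F"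
    using U_nbhd_self \<alpha> \<beta> p by (intro exI[of _ "U_nbhd L \<alpha> G \<times> U_nbhd L \<beta> H"]) auto
qed

lemma continuous_map_pinv: "continuous_map (tau_F L) (tau_F L) pinv"
proof (rule continuous_map_tau_FI)
  show "pinv \<in> topspace (tau_F L) \<rightarrow> I_infty L"
    by (auto simp: topspace_tau_F pinv_in_I_infty)
next
  fix \<alpha> F assume "\<alpha> \<in> topspace (tau_F L)" and F: "finite F" "F \<subseteq> dom (pinv \<alpha>)"
  then have \<alpha>: "\<alpha> \<in> I_infty L" by (simp add: topspace_tau_F)
  \<comment> \<open>Fixing the values of \<alpha> on the preimage of \<open>F\<close> fixes the
    values of its converse on \<open>F\<close>; domain and range merely swap roles.\<close>
  define G where "G = {x \<in> dom \<alpha>. the (\<alpha> x) \<in> F}"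
  have "pinv \<beta> \<in> U_nbhd L (pinv \<alpha>) F" if \<beta>: "\<beta> \<in> U_nbhd L \<alpha> G" for \<beta>
  proof -
    have \<beta>I: "\<beta> \<in> I_infty L" using \<beta> by (simp add: U_nbhd_def)
    have "pinv \<beta> y = pinv \<alpha> y" if y: "y \<in> F" for y
    proof -
      obtain x where x: "pinv \<alpha> y = Some x" using F(2) y by blast
      then have "\<alpha> x = Some y" by (simp add: pinv_eq_Some[OF \<alpha>])
      then have "\<beta> x = Some y" using \<beta> y by (force simp: U_nbhd_def G_def)
      then show ?thesis using x by (simp add: pinv_eq_Some[OF \<beta>I])
    qed
    then show ?thesis
      using \<beta> \<alpha> \<beta>I by (auto simp: U_nbhd_def pinv_in_I_infty dom_pinv ran_pinv)
  qed
  moreover have "openin (tau_F L) (U_nbhd L \<alpha> G)"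
    using finite_vimage_I_infty[OF \<alpha> F(1)] by (intro openin_U_nbhd_finite) (auto simp: G_def)
  ultimately show "\<exists>V. openin (tau_F L) V \<and> \<alpha> \<in> V \<and> pinv ` V \<subseteq> U_nbhd L (pinv \<alpha>) F"
    using U_nbhd_self[OF \<alpha>] by blast
qed

theorem proposition5p11:
  fixes L :: "'a set"
  assumes "infinite L"
  shows "topological_inverse_semigroup (I_infty L) pcomp (tau_F L) \<and> Tychonoff_space (tau_F L)"
proof -
  \<comment> \<open>The abstract inverse agrees with \<open>pinv\<close> on the underlying space, so
    continuity transfers.\<close>
  have "continuous_map (tau_F L) (tau_F L) (semigroup_inverse (I_infty L) pcomp)"
    by (rule continuous_map_eq[OF continuous_map_pinv])
      (simp add: topspace_tau_F semigroup_inverse_I_infty)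
  then show ?thesis
    unfolding topological_inverse_semigroup_def Tychonoff_space_def
    by (simp add: inverse_semigroup_I_infty topspace_tau_F continuous_map_pcomp
        completely_regular_tau_F Hausdorff_tau_F)
qed

end
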